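(* Let $f$ be a distribution in the dual of $A_\theta^\infty$, i.e. a formal Fourier series $\sum_{m,n}c_{m,n}U^mV^n$ with $\{c_{m,n}\}$ of tempered growth. Suppose $\overline\partial f$ is a (scalar) multiple of $\sum_{m,n\in\mathbb Z}U^mV^n$. Then $f$ is a constant, i.e. $c_{m,n}=0$ for all $(m,n)\ne(0,0)$.
   Context: Fix $\theta\in\mathbb R\smallsetminus\mathbb Q$. $A_\theta$ is the (universal) unital $C^*$-algebra generated by two unitaries $U,V$ with $UV=e^{2\pi i\theta}VU$. Its smooth subalgebra is $A_\theta^\infty=\{\sum_{m,n\in\mathbb Z}c_{m,n}U^mV^n: (c_{m,n})\text{ rapidly decreasing}\}$. The commuting derivations $\delta_1,\delta_2$ are given by $\delta_1(U)=2\pi iU$, $\delta_1(V)=0$, $\delta_2(U)=0$, $\delta_2(V)=2\pi iV$. Set $\overline\partial=\frac12(\delta_1+i\delta_2)$. Distributions (elements of the dual of $A_\theta^\infty$) are the formal Fourier series $\sum_{m,n}c_{m,n}U^mV^n$ whose coefficients have at most polynomial (tempered) growth, and $\overline\partial$ acts on them by $\overline\partial(\sum c_{m,n}U^mV^n)=\pi i\sum(m+in)c_{m,n}U^mV^n$. *)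

theory Defs
  imports Complex_Main
begin

text \<open>
  A formal Fourier series \<open>\<Sum>\<^sub>m\<^sub>,\<^sub>n c m n U\<^sup>m V\<^sup>n\<close> over the noncommutative torus, where
  \<open>U V = exp (2 \<pi> \<i> \<theta>) V U\<close>, is represented by its coefficient family \<open>c\<close>, indexed by all
  pairs of integers and always taken with respect to the ordered monomials \<open>U\<^sup>m V\<^sup>n\<close>.
  The parameter \<open>\<theta>\<close> only enters the product of such series; neither tempered growth nor the
  derivations below depend on it.
\<close>

type_synonym formal_fourier_series = "int \<Rightarrow> int \<Rightarrow> complex"

definition tempered_growth :: "formal_fourier_series \<Rightarrow> bool" where
  "tempered_growth c \<longleftrightarrow>
     (\<exists>(C::real) (k::nat). \<forall>m n. norm (c m n) \<le> C * (1 + \<bar>real_of_int m\<bar> + \<bar>real_of_int n\<bar>) ^ k)"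

text \<open>The dual of the smooth subalgebra, in its description by Fourier coefficients.\<close>

definition torus_distributions :: "formal_fourier_series set" where
  "torus_distributions = {c. tempered_growth c}"

definition torus_monomial :: "int \<Rightarrow> int \<Rightarrow> formal_fourier_series" where
  "torus_monomial p q = (\<lambda>m n. if m = p \<and> n = q then 1 else 0)"

definition series_add ::
    "formal_fourier_series \<Rightarrow> formal_fourier_series \<Rightarrow> formal_fourier_series" where
  "series_add c d = (\<lambda>m n. c m n + d m n)"

definition series_scale :: "complex \<Rightarrow> formal_fourier_series \<Rightarrow> formal_fourier_series" where
  "series_scale z c = (\<lambda>m n. z * c m n)"

text \<open>
  The derivations determined by \<open>\<delta>\<^sub>1 U = 2 \<pi> \<i> U\<close>, \<open>\<delta>\<^sub>1 V = 0\<close>, \<open>\<delta>\<^sub>2 U = 0\<close>, \<open>\<delta>\<^sub>2 V = 2 \<pi> \<i> V\<close>: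
  by the Leibniz rule \<open>\<delta>\<^sub>1 (U\<^sup>m V\<^sup>n) = 2 \<pi> \<i> m U\<^sup>m V\<^sup>n\<close> and \<open>\<delta>\<^sub>2 (U\<^sup>m V\<^sup>n) = 2 \<pi> \<i> n U\<^sup>m V\<^sup>n\<close>,
  extended termwise to formal series.
\<close>

definition delta1 :: "formal_fourier_series \<Rightarrow> formal_fourier_series" where
  "delta1 c = (\<lambda>m n. 2 * complex_of_real pi * \<i> * of_int m * c m n)"

definition delta2 :: "formal_fourier_series \<Rightarrow> formal_fourier_series" where
  "delta2 c = (\<lambda>m n. 2 * complex_of_real pi * \<i> * of_int n * c m n)"

definition delbar :: "formal_fourier_series \<Rightarrow> formal_fourier_series" where
  "delbar c = series_scale (1 / 2) (series_add (delta1 c) (series_scale \<i> (delta2 c)))"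

lemma delbar_coeff:
  "delbar c m n = complex_of_real pi * \<i> * (of_int m + \<i> * of_int n) * c m n"
  by (simp add: delbar_def series_scale_def series_add_def delta1_def delta2_def algebra_simps)

lemma delta_generators:
  "delta1 (torus_monomial 1 0) = series_scale (2 * complex_of_real pi * \<i>) (torus_monomial 1 0)"
  "delta1 (torus_monomial 0 1) = (\<lambda>m n. 0)"
  "delta2 (torus_monomial 1 0) = (\<lambda>m n. 0)"
  "delta2 (torus_monomial 0 1) = series_scale (2 * complex_of_real pi * \<i>) (torus_monomial 0 1)"
  by (auto simp: delta1_def delta2_def torus_monomial_def series_scale_def fun_eq_iff)

text \<open>The series \<open>\<Sum>\<^sub>m\<^sub>,\<^sub>n U\<^sup>m V\<^sup>n\<close>.\<close>

definition all_ones_series :: formal_fourier_series where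
  "all_ones_series = (\<lambda>m n. 1)"

lemma delbar_distribution:
  assumes "c \<in> torus_distributions"
  shows "delbar c \<in> torus_distributions"
proof -
  from assms obtain C k where
    C: "\<And>m n. norm (c m n) \<le> C * (1 + \<bar>real_of_int m\<bar> + \<bar>real_of_int n\<bar>) ^ k"
    by (auto simp: torus_distributions_def tempered_growth_def)
  have "norm (delbar c m n) \<le> (pi * C) * (1 + \<bar>real_of_int m\<bar> + \<bar>real_of_int n\<bar>) ^ Suc k" for m n
  proof -
    let ?w = "1 + \<bar>real_of_int m\<bar> + \<bar>real_of_int n\<bar>"
    have "norm (of_int m + \<i> * of_int n) \<le> \<bar>real_of_int m\<bar> + \<bar>real_of_int n\<bar>"
      by (rule order_trans[OF norm_triangle_ineq]) (simp add: norm_mult)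
    then have "norm (of_int m + \<i> * of_int n) \<le> ?w" by simp
    then have "norm (of_int m + \<i> * of_int n) * norm (c m n) \<le> ?w * (C * ?w ^ k)"
      using C[of m n] by (intro mult_mono) auto
    then have "pi * (norm (of_int m + \<i> * of_int n) * norm (c m n)) \<le> pi * (?w * (C * ?w ^ k))"
      by (rule mult_left_mono) simp
    then show ?thesis
      by (simp add: delbar_coeff norm_mult mult_ac)
  qed
  then show ?thesis
    unfolding torus_distributions_def tempered_growth_def by blast
qed

lemma all_ones_distribution: "all_ones_series \<in> torus_distributions"
proof -
  have "\<forall>m n. norm (all_ones_series m n) \<le> 1 * (1 + \<bar>real_of_int m\<bar> + \<bar>real_of_int n\<bar>) ^ 0"
    by (simp add: all_ones_series_def)
  then show ?thesis
    unfolding torus_distributions_def tempered_growth_def by blast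
qed

end

theory Submission
  imports Defs
begin

text \<open>
  In the basis \<open>U\<^sup>m V\<^sup>n\<close> the operator \<open>delbar\<close> is diagonal with eigenvalues \<open>\<pi> \<i> (m + \<i> n)\<close>, and
  the only vanishing eigenvalue is the one at the origin. Its vanishing there is an obstruction: the
  constant coefficient of \<open>delbar f\<close> is always \<open>0\<close>, whereas that of \<open>z \<Sum>\<^sub>m\<^sub>,\<^sub>n U\<^sup>m V\<^sup>n\<close> is \<open>z\<close>.
  So \<open>z = 0\<close> and \<open>delbar f = 0\<close>; as all other eigenvalues are invertible, \<open>f\<close> is
  supported at the origin.
\<close>

lemma delbar_eigenvalue_eq_0_iff:
  "complex_of_real pi * \<i> * (of_int m + \<i> * of_int n) = 0 \<longleftrightarrow> m = 0 \<and> n = 0"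
  by (auto simp: complex_eq_iff)

lemma delbar_kernel:
  assumes "delbar f = (\<lambda>m n. 0)" and "(m, n) \<noteq> (0, 0)"
  shows "f m n = 0"
proof -
  have "complex_of_real pi * \<i> * (of_int m + \<i> * of_int n) * f m n = 0"
    using fun_cong[OF fun_cong[OF assms(1)], of m n] unfolding delbar_coeff .
  then show ?thesis
    using assms(2) delbar_eigenvalue_eq_0_iff[of m n] by (metis mult_eq_0_iff)
qed

theorem proposition6p5:
  fixes \<theta> :: real and f :: formal_fourier_series
  assumes "\<theta> \<notin> \<rat>"
    and "f \<in> torus_distributions"
    and "\<exists>z::complex. delbar f = series_scale z all_ones_series"
  shows "\<forall>m n. (m, n) \<noteq> (0, 0) \<longrightarrow> f m n = 0"
proof -
  obtain z where z: "delbar f = series_scale z all_ones_series"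
    using assms(3) by blast
  have "z = delbar f 0 0"
    by (simp add: z series_scale_def all_ones_series_def)
  also have "\<dots> = 0"
    by (simp add: delbar_coeff)
  finally have "delbar f = (\<lambda>m n. 0)"
    using z by (simp add: series_scale_def)
  then show ?thesis
    using delbar_kernel by blast
qed

end
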